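(* Let $f$ be a Lipschitz continuous function on its domain $\Omega$ such that $\|D_{\mathbf z}f(\mathbf v,\mathbf z)\|\le L$ for any $\mathbf v,\mathbf z\in\Omega$, for some constant $L$. Let $\lambda_1\ge\lambda_2\ge\dots\ge\lambda_d$ be the eigenvalues of the matrix $\mathbf C=\mathbb E[\mathbb E[(D_{\mathbf z}f)(D_{\mathbf z}f)^T|\mathbf z]]$, let $1\le d_1<d$ with $\lambda_{d_1}>\lambda_{d_1+1}$, and let $\epsilon',\epsilon''>0$ be such that $$\frac{\epsilon''}{M_1}\sum_{j=1}^{M_1}\big\|\mathbb E[D_{\mathbf z}f\,D_{\mathbf z}f^T|\mathbf z^{(j)}]\big\|+\epsilon'\lambda_1\le\frac{\lambda_{d_1}-\lambda_{d_1+1}}5 .$$ Assume that the events $A=\{\|\tilde{\mathbf C}-\mathbf C\|\le\epsilon'\|\mathbf C\|\}$ and $A_j=\{\|\tilde{\mathbf C}_j-\mathbf C_j\|\le\epsilon''\|\mathbf C_j\|\}$, $j=1,\dots,M_1$, are independent. Then the probability $$P\left\{\|\hat{\mathbf C}-\mathbf C\|\le\frac{\epsilon''}{M_1}\sum_{j=1}^{M_1}\big\|\mathbb E[D_{\mathbf z}f\,D_{\mathbf z}f^T|\mathbf z^{(j)}]\big\|+\epsilon'\|\mathbf C\|\right\}$$ can be made arbitrarily close to one by taking $M_1,M_2$ sufficiently large, and therefore with high probability (i.e. with probability that can be made arbitrarily close to one by taking $M_1,M_2$ sufficiently large) $$\|\mathbf U_1^T\hat{\mathbf U}_2\|\le\frac{4\left(\frac{\epsilon''}{M_1}\sum_{j=1}^{M_1}\big\|\mathbb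 E[D_{\mathbf z}f\,D_{\mathbf z}f^T|\mathbf z^{(j)}]\big\|+\epsilon'\lambda_1\right)}{\lambda_{d_1}-\lambda_{d_1+1}} .$$
   Context: Setting: $\mathbb R^d$ carries the probability measure induced by a cumulative distribution function $\mathbf F(\mathbf z)=F_1(z_1)\cdots F_d(z_d)$ with continuous marginals $F_i$, concentrated on $\Omega\subseteq\mathbb R^d$. $f:\Omega\to\mathbb R$; all points at which $f$ is evaluated are assumed to lie in $\Omega$ (e.g. $\Omega=\mathbb R^d$). $\mathbf z,\mathbf v$ are independent with distribution $\mathbf F$, and $\mathbb E[\cdot|\mathbf z]$ averages over $\mathbf v$ with $\mathbf z$ fixed. $D_{\mathbf z}f(\mathbf v,\mathbf z)$ is the vector with entries $\dfrac{f(\mathbf v_{\{i\}}{:}\mathbf z_{-\{i\}})-f(\mathbf z)}{v_i-z_i}$, $i=1,\dots,d$, where $\mathbf v_{\{i\}}{:}\mathbf z_{-\{i\}}$ is $\mathbf z$ with its $i$th component replaced by $v_i$ (understood for $v_i\ne z_i$). The samples $\mathbf z^{(j)}$ ($1\le j\le M_1$) and $\mathbf v^{(j,i)}$ ($1\le j\le M_1$, $1\le i\le M_2$) are drawn independently from $\mathbf F$. Define $\mathbf C_j=\mathbb E[D_{\mathbf z}f\,D_{\mathbf z}f^T|\mathbf z^{(j)}]$, $\tilde{\mathbf C}=\frac1{M_1}\sum_{j=1}^{M_1}\mathbf C_j$, $\tilde{\mathbf C}_j=\frac1{M_2}\sum_{i=1}^{M_2}(D_{\mathbf z}f(\mathbf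 v^{(j,i)},\mathbf z^{(j)}))(D_{\mathbf z}f(\mathbf v^{(j,i)},\mathbf z^{(j)}))^T$, and the Monte Carlo estimate $\hat{\mathbf C}=\frac1{M_1}\sum_{j=1}^{M_1}\tilde{\mathbf C}_j$. Probabilities of the events $A_j$ are understood as conditional probabilities given the already sampled $\mathbf z^{(j)}$. Eigenvectors: $\mathbf C=\mathbf U\Lambda\mathbf U^T$ and $\hat{\mathbf C}=\hat{\mathbf U}\hat\Lambda\hat{\mathbf U}^T$ are eigenvalue decompositions with orthogonal $\mathbf U,\hat{\mathbf U}$ and eigenvalues in decreasing order; $\mathbf U=[\mathbf U_1\ \mathbf U_2]$, $\hat{\mathbf U}=[\hat{\mathbf U}_1\ \hat{\mathbf U}_2]$ with $\mathbf U_1,\hat{\mathbf U}_1\in\mathbb R^{d\times d_1}$. Matrix norms are spectral norms, vector norms are 2-norms. *)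

theory Defs
  imports "HOL-Probability.Probability"
begin

abbreviation spec_norm :: "real^'n^'m \<Rightarrow> real" where
  "spec_norm A \<equiv> onorm (\<lambda>x. A *v x)"

text \<open>The point written v_{i}:z_{-i} in the source: z with its i-th component replaced by that of v.\<close>

definition repl :: "real^'d \<Rightarrow> real^'d \<Rightarrow> 'd \<Rightarrow> real^'d" where
  "repl v z i = (\<chi> k. if k = i then v $ i else z $ k)"

text \<open>An entry with v$i = z$i takes the value 0, by division by zero; when the marginals are
  continuous this concerns only a null set.\<close>

definition Dz :: "(real^'d \<Rightarrow> real) \<Rightarrow> real^'d \<Rightarrow> real^'d \<Rightarrow> real^'d" where
  "Dz f v z = (\<chi> i. (f (repl v z i) - f z) / (v $ i - z $ i))"

definition outer :: "real^'d \<Rightarrow> real^'d^'d" where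
  "outer x = (\<chi> a b. x $ a * x $ b)"

text \<open>The conditional expectation of Dz f (Dz f)^T given z: v is averaged, z is held fixed.  The
  integrals run over Omega, where the measure is concentrated, because the values of f outside
  Omega are meaningless.\<close>

definition cond_C :: "(real^'d) measure \<Rightarrow> (real^'d) set \<Rightarrow> (real^'d \<Rightarrow> real) \<Rightarrow> real^'d \<Rightarrow> real^'d^'d" where
  "cond_C \<mu> \<Omega> f z = (LINT v:\<Omega>|\<mu>. outer (Dz f v z))"

definition full_C :: "(real^'d) measure \<Rightarrow> (real^'d) set \<Rightarrow> (real^'d \<Rightarrow> real) \<Rightarrow> real^'d^'d" where
  "full_C \<mu> \<Omega> f = (LINT z:\<Omega>|\<mu>. cond_C \<mu> \<Omega> f z)"

text \<open>In the following, \<open>zs j\<close> stands for z^(j) and \<open>vs j i\<close> for v^(j,i); indices start at 1.\<close>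

definition tilde_C :: "(real^'d) measure \<Rightarrow> (real^'d) set \<Rightarrow> (real^'d \<Rightarrow> real) \<Rightarrow> nat \<Rightarrow>
    (nat \<Rightarrow> real^'d) \<Rightarrow> real^'d^'d" where
  "tilde_C \<mu> \<Omega> f M1 zs = (1 / real M1) *\<^sub>R (\<Sum>j = 1..M1. cond_C \<mu> \<Omega> f (zs j))"

definition tilde_Cj :: "(real^'d \<Rightarrow> real) \<Rightarrow> nat \<Rightarrow> (nat \<Rightarrow> real^'d) \<Rightarrow> (nat \<Rightarrow> nat \<Rightarrow> real^'d) \<Rightarrow>
    nat \<Rightarrow> real^'d^'d" where
  "tilde_Cj f M2 zs vs j = (1 / real M2) *\<^sub>R (\<Sum>i = 1..M2. outer (Dz f (vs j i) (zs j)))"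

definition hat_C :: "(real^'d \<Rightarrow> real) \<Rightarrow> nat \<Rightarrow> nat \<Rightarrow> (nat \<Rightarrow> real^'d) \<Rightarrow>
    (nat \<Rightarrow> nat \<Rightarrow> real^'d) \<Rightarrow> real^'d^'d" where
  "hat_C f M1 M2 zs vs = (1 / real M1) *\<^sub>R (\<Sum>j = 1..M1. tilde_Cj f M2 zs vs j)"

definition avg_norm_C :: "(real^'d) measure \<Rightarrow> (real^'d) set \<Rightarrow> (real^'d \<Rightarrow> real) \<Rightarrow> nat \<Rightarrow>
    (nat \<Rightarrow> real^'d) \<Rightarrow> real" where
  "avg_norm_C \<mu> \<Omega> f M1 zs = (1 / real M1) * (\<Sum>j = 1..M1. spec_norm (cond_C \<mu> \<Omega> f (zs j)))"

text \<open>The sub-sigma-algebra generated by z^(1), ..., z^(M1), and independence of a family of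
  events with respect to the conditional probabilities given a sub-sigma-algebra.\<close>

definition sigma_Z :: "'w measure \<Rightarrow> (nat \<Rightarrow> 'w \<Rightarrow> real^'d) \<Rightarrow> nat \<Rightarrow> 'w measure" where
  "sigma_Z M Z M1 = vimage_algebra (space M) (\<lambda>\<omega>. \<lambda>j\<in>{1..M1}. Z j \<omega>) (PiM {1..M1} (\<lambda>_. borel))"

definition cond_indep_events :: "'w measure \<Rightarrow> 'w measure \<Rightarrow> ('i \<Rightarrow> 'w set) \<Rightarrow> 'i set \<Rightarrow> bool" where
  "cond_indep_events M G E I \<longleftrightarrow> (\<forall>i\<in>I. E i \<in> sets M) \<and>
     (\<forall>J\<subseteq>I. J \<noteq> {} \<longrightarrow> finite J \<longrightarrow>
       (AE \<omega> in M. real_cond_exp M G (indicator (\<Inter>j\<in>J. E j)) \<omega> =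
                   (\<Prod>j\<in>J. real_cond_exp M G (indicator (E j)) \<omega>)))"

text \<open>\<open>pos i\<close> is the position, counted from 1, of i in the linearly ordered finite index type;
  it identifies the index type with {1..d}.\<close>

definition pos :: "'n::{finite,linorder} \<Rightarrow> nat" where
  "pos i = card {..i}"

lemma bij_betw_pos: "bij_betw pos (UNIV :: 'n::{finite,linorder} set) {1..CARD('n)}"
proof -
  have inj: "inj (pos :: 'n \<Rightarrow> nat)"
  proof (rule injI)
    fix x y :: 'n
    assume "pos x = pos y"
    then have c: "card {..x} = card {..y}" by (simp add: pos_def)
    have "{..x} \<subseteq> {..y} \<or> {..y} \<subseteq> {..x}" by (metis atMost_subset_iff linear)
    with c have "{..x} = {..y}" by (metis card_subset_eq finite)
    then show "x = y" by (simp add: atMost_eq_iff)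
  qed
  have "range (pos :: 'n \<Rightarrow> nat) \<subseteq> {1..CARD('n)}"
  proof (rule image_subsetI)
    fix i :: 'n
    have "0 < card {..i}" by (subst card_gt_0_iff) auto
    moreover have "card {..i} \<le> CARD('n)" by (rule card_mono) auto
    ultimately show "pos i \<in> {1..CARD('n)}" by (simp add: pos_def)
  qed
  moreover have "card (range (pos :: 'n \<Rightarrow> nat)) = card {1..CARD('n)}"
    by (simp add: card_image inj)
  ultimately have "range (pos :: 'n \<Rightarrow> nat) = {1..CARD('n)}"
    by (intro card_subset_eq) auto
  with inj show ?thesis by (simp add: bij_betw_def)
qed

text \<open>\<open>eig_decomp A U l\<close>: A = U diag(l 1, ..., l d) U^T with U orthogonal and l 1 >= ... >= l d.\<close>

definition eig_decomp :: "real^('d::{finite,linorder})^('d::{finite,linorder}) \<Rightarrow> real^('d::{finite,linorder})^('d::{finite,linorder}) \<Rightarrow> (nat \<Rightarrow> real) \<Rightarrow> bool" where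
  "eig_decomp A U l \<longleftrightarrow> orthogonal_matrix U \<and>
     A = U ** (\<chi> i j. if i = j then l (pos i) else 0) ** transpose U \<and>
     (\<forall>k. 1 \<le> k \<and> k < CARD('d) \<longrightarrow> l (k + 1) \<le> l k)"

text \<open>The blocks of the first CARD('p) and of the last CARD('q) columns of a square matrix.\<close>

definition first_cols :: "real^('d::{finite,linorder})^('d::{finite,linorder}) \<Rightarrow> real^('p::{finite,linorder})^('d::{finite,linorder})" where
  "first_cols U = (\<chi> r c. U $ r $ inv pos (pos c))"

definition last_cols :: "real^('d::{finite,linorder})^('d::{finite,linorder}) \<Rightarrow> real^('q::{finite,linorder})^('d::{finite,linorder})" where
  "last_cols U = (\<chi> r c. U $ r $ inv pos (CARD('d) - CARD('q) + pos c))"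

end

theory Submission
  imports Defs
begin

text \<open>
  Both conclusions follow from one event of high probability, on which
  \<open>\<parallel>hat_C - C\<parallel> \<le> \<epsilon>' \<lambda>\<^sub>1\<close>; the remaining argument is deterministic.

  Probability.  The matrix \<open>hat_C\<close> is the mean over \<open>j\<close> of the matrices \<open>tilde_Cj\<close>.  These are
  independent, because \<open>tilde_Cj\<close> is computed from \<open>z^(j)\<close> and the \<open>v^(j,i)\<close> alone; each has
  expectation \<open>C\<close> by Fubini; and their entries are bounded by the square of the Lipschitz constant
  of \<open>f\<close>, since every entry of \<open>Dz f\<close> is a difference quotient of \<open>f\<close> along a coordinate axis.
  Hoeffding's inequality, applied to each entry, therefore makes \<open>\<parallel>hat_C - C\<parallel>\<close> smaller than any
  fixed positive number with probability tending to one as \<open>M1\<close> grows, uniformly in \<open>M2 \<ge> 1\<close>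
  (\<open>hat_C_concentration\<close>).  Comparing \<open>hat_C\<close> with \<open>C\<close> directly, instead of bounding each
  \<open>tilde_Cj - C_j\<close> and taking a union over \<open>j\<close>, is what allows the threshold for \<open>M2\<close> to be
  independent of \<open>M1\<close>.  The fixed number \<open>\<epsilon>' \<lambda>\<^sub>1\<close> is admissible: \<open>C\<close> is positive semidefinite, so
  the spectral gap forces \<open>\<lambda>\<^sub>1 > 0\<close>, and \<open>\<lambda>\<^sub>1 \<le> \<parallel>C\<parallel>\<close>.

  Linear algebra.  Let \<open>E = hat_C - C\<close>, \<open>W = U\<^sub>1\<^sup>T hat_U\<^sub>2\<close> and \<open>gap = \<lambda>_d1 - \<lambda>_(d1+1)\<close>.  Then \<open>W\<close>
  solves the Sylvester equation \<open>\<Lambda>\<^sub>1 W - W hat_\<Lambda>\<^sub>2 = - U\<^sub>1\<^sup>T E hat_U\<^sub>2\<close>.  The entries of \<open>\<Lambda>\<^sub>1\<close> are at least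
  \<open>\<lambda>_d1\<close>, and by Weyl's inequality those of \<open>hat_\<Lambda>\<^sub>2\<close> are at most \<open>\<lambda>_(d1+1) + \<parallel>E\<parallel>\<close>.  This gives the
  Davis-Kahan bound \<open>(gap - \<parallel>E\<parallel>) \<parallel>W\<parallel> \<le> \<parallel>E\<parallel>\<close> (\<open>eigenspace_perturbation\<close>).  When
  \<open>\<parallel>E\<parallel> \<le> s \<le> gap / 5\<close>, it yields \<open>\<parallel>W\<parallel> \<le> 5 s / (4 gap)\<close>, which is below \<open>4 s / gap\<close>.
\<close>

section \<open>Perturbation of eigenvalues and eigenspaces\<close>

(* By default every transpose P *v y is turned into y v* P, which would hide the composition of
   transpose P with other matrices. *)
declare transpose_matrix_vector [simp del]

lemma isometry_norm:
  fixes P :: "real^'p^'n"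
  assumes "transpose P ** P = mat 1"
  shows "norm (P *v x) = norm x"
proof -
  have "(P *v x) \<bullet> (P *v x) = (transpose P *v (P *v x)) \<bullet> x"
    by (metis dot_lmul_matrix inner_commute vector_transpose_matrix transpose_matrix_vector)
  also have "\<dots> = x \<bullet> x"
    by (simp add: matrix_vector_mul_assoc assms)
  finally show ?thesis by (simp add: norm_eq_sqrt_inner)
qed

text \<open>The vector \<open>P P\<^sup>T y\<close> has the same norm as \<open>P\<^sup>T y\<close>, so \<open>\<parallel>P\<^sup>T y\<parallel>\<^sup>2 = y \<bullet> P P\<^sup>T y\<close> is at most
  \<open>\<parallel>y\<parallel> \<parallel>P\<^sup>T y\<parallel>\<close> by Cauchy-Schwarz.\<close>
lemma isometry_transpose_norm_le:
  fixes P :: "real^'p^'n"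
  assumes "transpose P ** P = mat 1"
  shows "norm (transpose P *v y) \<le> norm y"
proof -
  have "norm (transpose P *v y) ^ 2 = y \<bullet> (P *v (transpose P *v y))"
    by (metis dot_lmul_matrix power2_norm_eq_inner transpose_matrix_vector)
  also have "\<dots> \<le> norm y * norm (transpose P *v y)"
    by (metis norm_cauchy_schwarz isometry_norm[OF assms])
  finally show ?thesis
    by (metis mult_right_le_imp_le norm_ge_zero norm_zero not_le order_le_less power2_eq_square)
qed

text \<open>The columns of \<open>P\<close> and \<open>Q\<close> span invariant subspaces of \<open>A\<close> and \<open>B\<close> whose spectra are separated
  by a gap \<open>g\<close>.  With \<open>W = P\<^sup>T Q\<close> and both spectra shifted by \<open>\<alpha>\<close>, the Sylvester equation reads
  \<open>(\<Lambda>\<^sub>a - \<alpha>) W = W (\<Lambda>\<^sub>b - \<alpha>) - P\<^sup>T (B - A) Q\<close>.  After the shift, \<open>\<Lambda>\<^sub>b - \<alpha>\<close> has norm at most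
  \<open>r = \<beta> - \<alpha>\<close>, while \<open>\<Lambda>\<^sub>a - \<alpha>\<close> stretches every vector by at least \<open>r + g\<close>.  Hence
  \<open>(r + g) \<parallel>W\<parallel> \<le> r \<parallel>W\<parallel> + \<parallel>B - A\<parallel>\<close>, and \<open>r\<close> cancels.\<close>
lemma spec_norm_sin_theta:
  fixes A B :: "real^'n^'n" and P :: "real^'p^'n" and Q :: "real^'q^'n"
  assumes P: "transpose P ** P = mat 1" and Q: "transpose Q ** Q = mat 1"
    and AP: "\<And>y c. (transpose P *v (A *v y)) $ c = a c * (transpose P *v y) $ c"
    and BQ: "\<And>x. B *v (Q *v x) = Q *v (\<chi> c. b c * x $ c)"
    and a: "\<And>c. \<beta> + g \<le> a c" and b: "\<And>c. \<alpha> \<le> b c" "\<And>c. b c \<le> \<beta>"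
    and g: "0 < g"
  shows "g * spec_norm (transpose P ** Q) \<le> spec_norm (B - A)"
proof -
  define W where "W = transpose P ** Q"
  define e where "e = spec_norm (B - A)"
  define r where "r = \<beta> - \<alpha>"
  have r: "0 \<le> r" using b[of undefined] by (simp add: r_def)
  have key: "norm (W *v x) \<le> (spec_norm W * r + e) / (r + g) * norm x" for x
  proof -
    let ?x' = "\<chi> c. (b c - \<alpha>) * x $ c"
    let ?Ex = "transpose P *v ((B - A) *v (Q *v x))"
    have "(r + g) * norm (W *v x) = norm ((r + g) *\<^sub>R (W *v x))"
      using r g by simp
    also have "\<dots> \<le> norm (\<chi> c. (a c - \<alpha>) * (W *v x) $ c)"
    proof (rule norm_le_componentwise_cart)
      fix c
      have "r + g \<le> a c - \<alpha>" using a[of c] by (simp add: r_def)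
      then show "norm (((r + g) *\<^sub>R (W *v x)) $ c) \<le> norm ((\<chi> c. (a c - \<alpha>) * (W *v x) $ c) $ c)"
        using r g by (auto simp: abs_mult intro!: mult_right_mono)
    qed
    also have "(\<chi> c. (a c - \<alpha>) * (W *v x) $ c) = W *v ?x' - ?Ex"
    proof -
      have Wv: "W *v u = transpose P *v (Q *v u)" for u
        by (simp add: W_def matrix_vector_mul_assoc)
      have "?x' = (\<chi> c. b c * x $ c) - \<alpha> *\<^sub>R x"
        by (simp add: vec_eq_iff algebra_simps)
      then have "W *v ?x' = transpose P *v (B *v (Q *v x)) - \<alpha> *\<^sub>R (W *v x)"
        by (simp add: matrix_vector_mult_diff_distrib matrix_vector_mult_scaleR BQ Wv)
      then have "W *v ?x' - ?Ex = transpose P *v (A *v (Q *v x)) - \<alpha> *\<^sub>R (W *v x)"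
        by (simp add: matrix_vector_mult_diff_distrib matrix_vector_mult_diff_rdistrib)
      moreover have "transpose P *v (A *v (Q *v x)) = (\<chi> c. a c * (W *v x) $ c)"
        by (simp add: vec_eq_iff AP Wv)
      ultimately show ?thesis
        by (simp add: vec_eq_iff algebra_simps)
    qed
    also have "norm \<dots> \<le> norm (W *v ?x') + norm ?Ex"
      by (rule norm_triangle_ineq4)
    also have "norm (W *v ?x') \<le> spec_norm W * (r * norm x)"
    proof -
      have "norm ?x' \<le> norm (r *\<^sub>R x)"
      proof (rule norm_le_componentwise_cart)
        fix c show "norm (?x' $ c) \<le> norm ((r *\<^sub>R x) $ c)"
          using b[of c] by (auto simp: abs_mult r_def intro!: mult_right_mono)
      qed
      then have "norm ?x' \<le> r * norm x" using r by simp
      then show ?thesis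
        by (meson matrix_vector_mul_bounded_linear mult_left_mono onorm onorm_pos_le order_trans)
    qed
    also have "norm ?Ex \<le> e * norm x"
    proof -
      have "norm ?Ex \<le> norm ((B - A) *v (Q *v x))"
        by (rule isometry_transpose_norm_le[OF P])
      also have "\<dots> \<le> e * norm (Q *v x)"
        unfolding e_def by (rule onorm) simp
      finally show ?thesis by (simp add: isometry_norm[OF Q])
    qed
    finally have "(r + g) * norm (W *v x) \<le> (spec_norm W * r + e) * norm x"
      by (simp add: algebra_simps)
    then show ?thesis using r g by (simp add: field_simps)
  qed
  have "spec_norm W \<le> (spec_norm W * r + e) / (r + g)"
    by (rule onorm_le) (rule key)
  then have "spec_norm W * (r + g) \<le> spec_norm W * r + e"
    using r g by (simp add: pos_le_divide_eq)
  then show ?thesis by (simp add: W_def e_def algebra_simps)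
qed

lemma eig_decomp_mono:
  fixes A :: "real^('d::{finite,linorder})^('d::{finite,linorder})"
  assumes "eig_decomp A U l" "1 \<le> i" "i \<le> j" "j \<le> CARD('d)"
  shows "l j \<le> l i"
  using assms(3,2,4)
proof (induction rule: dec_induct)
  case (step n)
  then have "l (n + 1) \<le> l n"
    using assms(1) unfolding eig_decomp_def by auto
  with step show ?case by simp
qed simp

lemma pos_range: "1 \<le> pos (i :: 'd::{finite,linorder})" "pos i \<le> CARD('d)"
  using bij_betw_apply[OF bij_betw_pos, of i] by auto

lemma pos_inv:
  assumes "1 \<le> k" "k \<le> CARD('d::{finite,linorder})"
  shows "pos (inv pos k :: 'd) = k"
  using bij_betw_inv_into_right[OF bij_betw_pos, of k] assms by auto

lemma diagonal_matrix_vector_mult: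
  fixes x :: "real^'n"
  shows "(\<chi> i j. if i = j then a i else 0) *v x = (\<chi> i. a i * x $ i)"
  by (simp add: vec_eq_iff matrix_vector_mult_def mult_delta_left)

lemma eig_decomp_transpose:
  fixes A :: "real^('d::{finite,linorder})^('d::{finite,linorder})"
  assumes "eig_decomp A U l"
  shows "(transpose U *v (A *v y)) $ i = l (pos i) * (transpose U *v y) $ i"
proof -
  let ?D = "(\<chi> i j. if i = j then l (pos i) else 0)"
  have U: "transpose U ** U = mat 1" "A = U ** ?D ** transpose U"
    using assms by (auto simp: eig_decomp_def orthogonal_matrix_def)
  have "transpose U ** A = (transpose U ** U) ** (?D ** transpose U)"
    unfolding U(2) by (simp add: matrix_mul_assoc)
  then have "transpose U *v (A *v y) = ?D *v (transpose U *v y)"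
    by (simp add: U(1) matrix_vector_mul_assoc)
  also have "\<dots> $ i = l (pos i) * (transpose U *v y) $ i"
    unfolding diagonal_matrix_vector_mult by simp
  finally show ?thesis .
qed

lemma eig_decomp_column:
  fixes A :: "real^('d::{finite,linorder})^('d::{finite,linorder})"
  assumes "eig_decomp A U l"
  shows "A *v column i U = l (pos i) *\<^sub>R column i U"
proof -
  let ?D = "(\<chi> i j. if i = j then l (pos i) else 0)"
  have U: "transpose U ** U = mat 1" "A = U ** ?D ** transpose U"
    using assms by (auto simp: eig_decomp_def orthogonal_matrix_def)
  have c: "column i U = U *v axis i 1" by (simp add: matrix_vector_mult_basis)
  have D: "?D *v axis i 1 = l (pos i) *\<^sub>R axis i 1"
    unfolding diagonal_matrix_vector_mult by (simp add: vec_eq_iff axis_def)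
  have "A *v column i U = (U ** ?D ** (transpose U ** U)) *v axis i 1"
    unfolding c U(2) by (simp add: matrix_vector_mul_assoc matrix_mul_assoc)
  also have "\<dots> = U *v (?D *v axis i 1)"
    by (simp add: U(1) matrix_vector_mul_assoc)
  finally show ?thesis by (simp add: D matrix_vector_mult_scaleR c)
qed

lemma eig_decomp_norm_column:
  fixes A :: "real^('d::{finite,linorder})^('d::{finite,linorder})"
  assumes "eig_decomp A U l"
  shows "norm (column i U) = 1"
  using assms by (auto simp: eig_decomp_def orthogonal_matrix_orthonormal_columns)

lemma eig_decomp_quadratic_form:
  fixes A :: "real^('d::{finite,linorder})^('d::{finite,linorder})"
  assumes "eig_decomp A U l"
  shows "x \<bullet> (A *v x) = (\<Sum>i\<in>UNIV. l (pos i) * (column i U \<bullet> x)\<^sup>2)"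
    and "x \<bullet> x = (\<Sum>i\<in>UNIV. (column i U \<bullet> x)\<^sup>2)"
proof -
  have U: "U ** transpose U = mat 1" 
    using assms by (auto simp: eig_decomp_def orthogonal_matrix_def)
  have inner: "x \<bullet> y = (transpose U *v x) \<bullet> (transpose U *v y)" for y
    by (metis U dot_lmul_matrix matrix_vector_mul_assoc matrix_vector_mul_lid transpose_matrix_vector)
  have comp: "(transpose U *v y) $ i = column i U \<bullet> y" for y i
    by (simp add: matrix_vector_mult_def transpose_def column_def inner_vec_def)
  show "x \<bullet> (A *v x) = (\<Sum>i\<in>UNIV. l (pos i) * (column i U \<bullet> x)\<^sup>2)"
    unfolding inner[of "A *v x"]
    unfolding inner_vec_def[of "transpose U *v x"] eig_decomp_transpose[OF assms]
    by (simp add: comp power2_eq_square algebra_simps)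
  show "x \<bullet> x = (\<Sum>i\<in>UNIV. (column i U \<bullet> x)\<^sup>2)"
    unfolding inner[of x] inner_vec_def[of "transpose U *v x"]
    by (simp add: comp power2_eq_square)
qed

text \<open>One half of Weyl's inequality.  The \<open>k - 1\<close> leading eigenvectors of \<open>A\<close> and the \<open>d - k\<close> trailing
  eigenvectors of \<open>B\<close> are fewer than \<open>d\<close> vectors, so some nonzero \<open>x\<close> is orthogonal to all of them.
  For this \<open>x\<close> the Rayleigh quotient of \<open>A\<close> is at most the \<open>k\<close>-th eigenvalue of \<open>A\<close>, that of \<open>B\<close> is
  at least the \<open>k\<close>-th eigenvalue of \<open>B\<close>, and the two differ by at most \<open>\<parallel>B - A\<parallel>\<close>.\<close>
lemma eigenvalue_perturbation:
  fixes A B :: "real^('d::{finite,linorder})^('d::{finite,linorder})"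
  assumes A: "eig_decomp A U l" and B: "eig_decomp B V m"
    and k: "1 \<le> k" "k \<le> CARD('d)"
  shows "m k \<le> l k + spec_norm (B - A)"
proof -
  let ?I = "{i :: 'd. pos i < k}" and ?J = "{j :: 'd. k < pos j}"
  let ?S = "(\<lambda>i. column i U) ` ?I \<union> (\<lambda>j. column j V) ` ?J"
  have "dim ?S \<le> card ?S"
    by (rule dim_le_card) (auto intro: span_base)
  also have "\<dots> \<le> card ?I + card ?J"
    by (rule order_trans[OF card_Un_le]) (intro add_mono card_image_le finite)
  also have "\<dots> = card (?I \<union> ?J)"
    by (subst card_Un_disjoint) auto
  also have "\<dots> < CARD('d)"
  proof (rule psubset_card_mono)
    show "?I \<union> ?J \<subset> UNIV"
    proof -
      have "inv pos k \<notin> ?I \<union> ?J" using pos_inv[OF k] by simp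
      then show ?thesis by blast
    qed
  qed simp
  finally have "dim ?S < DIM(real^('d::{finite,linorder}))" by simp
  from orthogonal_to_subspace_exists[OF this]
  obtain x where x: "x \<noteq> 0" "\<And>y. y \<in> span ?S \<Longrightarrow> orthogonal x y" by auto
  have xI: "column i U \<bullet> x = 0" if "pos i < k" for i
    using x(2)[OF span_base, of "column i U"] that by (auto simp: orthogonal_def inner_commute)
  have xJ: "column j V \<bullet> x = 0" if "k < pos j" for j
    using x(2)[OF span_base, of "column j V"] that by (auto simp: orthogonal_def inner_commute)
  have lo: "m k * (x \<bullet> x) \<le> x \<bullet> (B *v x)"
    unfolding eig_decomp_quadratic_form(1)[OF B]
    unfolding eig_decomp_quadratic_form(2)[OF B] sum_distrib_left
  proof (rule sum_mono)
    fix i show "m k * (column i V \<bullet> x)\<^sup>2 \<le> m (pos i) * (column i V \<bullet> x)\<^sup>2"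
    proof (cases "k < pos i")
      case False
      then have "m k \<le> m (pos i)"
        using k pos_range[of i] by (intro eig_decomp_mono[OF B]) auto
      then show ?thesis by (simp add: mult_right_mono)
    qed (simp add: xJ)
  qed
  have hi: "x \<bullet> (A *v x) \<le> l k * (x \<bullet> x)"
    unfolding eig_decomp_quadratic_form(1)[OF A]
    unfolding eig_decomp_quadratic_form(2)[OF A] sum_distrib_left
  proof (rule sum_mono)
    fix i show "l (pos i) * (column i U \<bullet> x)\<^sup>2 \<le> l k * (column i U \<bullet> x)\<^sup>2"
    proof (cases "pos i < k")
      case False
      then have "l (pos i) \<le> l k"
        using k pos_range[of i] by (intro eig_decomp_mono[OF A]) auto
      then show ?thesis by (simp add: mult_right_mono)
    qed (simp add: xI)
  qed
  have "x \<bullet> ((B - A) *v x) \<le> norm x * (spec_norm (B - A) * norm x)"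
    by (meson matrix_vector_mul_bounded_linear mult_left_mono norm_cauchy_schwarz norm_ge_zero
        onorm order_trans)
  also have "\<dots> = spec_norm (B - A) * (x \<bullet> x)"
    by (simp add: dot_square_norm power2_eq_square)
  finally have "x \<bullet> (B *v x) - x \<bullet> (A *v x) \<le> spec_norm (B - A) * (x \<bullet> x)"
    by (simp add: matrix_vector_mult_diff_rdistrib inner_diff_right)
  with lo hi have "m k * (x \<bullet> x) \<le> (l k + spec_norm (B - A)) * (x \<bullet> x)"
    by (simp add: algebra_simps)
  then show ?thesis using x(1) by simp
qed

lemma selected_columns_isometry:
  fixes U :: "real^'n^'n" and h :: "'p::finite \<Rightarrow> 'n"
  assumes "orthogonal_matrix U" "inj h"
  shows "transpose (\<chi> r c. U $ r $ h c) ** (\<chi> r c. U $ r $ h c) = mat 1"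
proof -
  have "transpose U ** U = mat 1" using assms(1) by (simp add: orthogonal_matrix)
  then have "(\<Sum>r\<in>UNIV. U $ r $ i * U $ r $ j) = (if i = j then 1 else 0)" for i j
    by (simp add: vec_eq_iff matrix_matrix_mult_def transpose_def mat_def)
  then show ?thesis
    using assms(2) by (auto simp: vec_eq_iff matrix_matrix_mult_def transpose_def mat_def inj_eq)
qed

text \<open>The Davis-Kahan theorem in terms of the gap of \<open>A\<close> alone.  The sine-theta bound needs a gap between
  the leading spectrum of \<open>A\<close> and the trailing spectrum of \<open>B\<close>; Weyl's inequality shows that the
  perturbation shrinks the gap of \<open>A\<close> by at most \<open>\<parallel>B - A\<parallel>\<close>.\<close>
theorem eigenspace_perturbation:
  fixes A B :: "real^('d::{finite,linorder})^('d::{finite,linorder})"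
  assumes A: "eig_decomp A U l" and B: "eig_decomp B V m"
    and k: "CARD('p::{finite,linorder}) = k" "CARD('q::{finite,linorder}) = CARD('d) - k" "k < CARD('d)"
    and gap: "spec_norm (B - A) < l k - l (k + 1)"
  shows "(l k - l (k + 1) - spec_norm (B - A)) *
      spec_norm (transpose (first_cols U :: real^('p::{finite,linorder})^('d::{finite,linorder})) ** (last_cols V :: real^('q::{finite,linorder})^('d::{finite,linorder})))
    \<le> spec_norm (B - A)"
proof -
  \<comment> \<open>Column \<open>c\<close> of each block is column \<open>h1 c\<close> of \<open>U\<close>, respectively \<open>h2 c\<close> of \<open>V\<close>.\<close>
  define h1 :: "'p \<Rightarrow> 'd" where "h1 c = inv pos (pos c)" for c
  define h2 :: "'q \<Rightarrow> 'd" where "h2 c = inv pos (k + pos c)" for c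
  have k1: "1 \<le> k" unfolding k(1)[symmetric] by (simp add: Suc_le_eq)
  have h1: "pos (h1 c) = pos c" for c
    unfolding h1_def using pos_range[of c] k by (intro pos_inv) auto
  have h2: "pos (h2 c) = k + pos c" for c
    unfolding h2_def using pos_range[of c] k by (intro pos_inv) auto
  have inj_pos: "inj (pos :: 'x::{finite,linorder} \<Rightarrow> nat)"
    using bij_betw_pos by (auto simp: bij_betw_def)
  have "inj h1"
    by (rule injI) (metis h1 inj_pos injD)
  moreover have "inj h2"
    by (rule injI) (metis h2 inj_pos injD add_left_cancel)
  moreover have F: "(first_cols U :: real^('p::{finite,linorder})^('d::{finite,linorder})) = (\<chi> r c. U $ r $ h1 c)"
    by (simp add: first_cols_def h1_def)
  moreover have G: "(last_cols V :: real^('q::{finite,linorder})^('d::{finite,linorder})) = (\<chi> r c. V $ r $ h2 c)"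
    using k by (simp add: last_cols_def h2_def)
  ultimately have iso: "transpose (first_cols U :: real^('p::{finite,linorder})^('d::{finite,linorder})) ** first_cols U = mat 1"
    "transpose (last_cols V :: real^('q::{finite,linorder})^('d::{finite,linorder})) ** last_cols V = mat 1"
    using A B by (auto simp: eig_decomp_def intro!: selected_columns_isometry)
  have AP: "(transpose (first_cols U :: real^('p::{finite,linorder})^('d::{finite,linorder})) *v (A *v y)) $ c
      = l (pos c) * (transpose (first_cols U :: real^('p::{finite,linorder})^('d::{finite,linorder})) *v y) $ c" for y c
    using eig_decomp_transpose[OF A, of y "h1 c"]
    by (simp add: F matrix_vector_mult_def transpose_def h1)
  have BQ: "B *v ((last_cols V :: real^('q::{finite,linorder})^('d::{finite,linorder})) *v x) = last_cols V *v (\<chi> c. m (k + pos c) * x $ c)" for x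
  proof -
    have col: "(last_cols V :: real^('q::{finite,linorder})^('d::{finite,linorder})) *v u = (\<Sum>c\<in>UNIV. u $ c *\<^sub>R column (h2 c) V)" for u
      by (simp add: G vec_eq_iff matrix_vector_mult_def column_def algebra_simps)
    show ?thesis
      by (simp add: col matrix_vector_mult_scaleR linear_sum[OF matrix_vector_mul_linear]
          eig_decomp_column[OF B] h2 mult.commute)
  qed
  have a: "m (k + 1) + (l k - m (k + 1)) \<le> l (pos c)" for c :: 'p
    using eig_decomp_mono[OF A, of "pos c" k] pos_range[of c] k by auto
  have b: "m CARD('d) \<le> m (k + pos c)" "m (k + pos c) \<le> m (k + 1)" for c :: 'q
    using eig_decomp_mono[OF B] pos_range[of c] k by auto
  let ?W = "transpose (first_cols U :: real^('p::{finite,linorder})^('d::{finite,linorder})) ** (last_cols V :: real^('q::{finite,linorder})^('d::{finite,linorder}))"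
  have weyl: "m (k + 1) \<le> l (k + 1) + spec_norm (B - A)"
    using k by (intro eigenvalue_perturbation[OF A B]) auto
  have "(l k - m (k + 1)) * spec_norm ?W \<le> spec_norm (B - A)"
    using weyl gap by (intro spec_norm_sin_theta[OF iso AP BQ a b]) auto
  moreover have "(l k - l (k + 1) - spec_norm (B - A)) * spec_norm ?W
      \<le> (l k - m (k + 1)) * spec_norm ?W"
    using weyl by (intro mult_right_mono onorm_pos_le) auto
  ultimately show ?thesis by linarith
qed

section \<open>Concentration of nested averages\<close>

context prob_space begin

text \<open>Hoeffding's inequality for intervals of length \<open>2 B\<close>, rescaled from sums to means.\<close>
lemma bounded_mean_concentration:
  fixes X :: "nat \<Rightarrow> 'a \<Rightarrow> real"
  assumes indep: "indep_vars (\<lambda>_. borel) X {1..n}"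
    and bound: "\<And>j \<omega>. j \<in> {1..n} \<Longrightarrow> \<omega> \<in> space M \<Longrightarrow> \<bar>X j \<omega>\<bar> \<le> B"
    and mean: "\<And>j. j \<in> {1..n} \<Longrightarrow> expectation (X j) = m"
    and "1 \<le> n" "0 < B" "0 < \<tau>"
  shows "prob {\<omega> \<in> space M. \<tau> \<le> \<bar>(\<Sum>j = 1..n. X j \<omega>) / real n - m\<bar>}
    \<le> 2 * exp (- (\<tau>\<^sup>2 / (2 * B\<^sup>2)) * real n)"
proof -
  interpret Hoeffding_ineq M "{1..n}" X "\<lambda>_. - B" "\<lambda>_. B" "\<Sum>j = 1..n. expectation (X j)"
  proof unfold_locales
    show "AE \<omega> in M. X j \<omega> \<in> {- B..B}" if "j \<in> {1..n}" for j
      by (rule AE_I2) (use bound[OF that] in \<open>simp add: abs_le_iff minus_le_iff\<close>)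
  qed (simp, rule indep)
  have "\<tau> \<le> \<bar>s / real n - m\<bar> \<longleftrightarrow> real n * \<tau> \<le> \<bar>s - real n * m\<bar>" for s
  proof -
    have "\<bar>s / real n - m\<bar> = \<bar>s - real n * m\<bar> / real n"
      using \<open>1 \<le> n\<close> by (simp add: abs_div_pos[symmetric] field_simps)
    then show ?thesis using \<open>1 \<le> n\<close> by (simp add: pos_le_divide_eq mult.commute)
  qed
  then have "{\<omega> \<in> space M. \<tau> \<le> \<bar>(\<Sum>j = 1..n. X j \<omega>) / real n - m\<bar>}
      = {\<omega> \<in> space M. real n * \<tau> \<le> \<bar>(\<Sum>j = 1..n. X j \<omega>) - (\<Sum>j = 1..n. expectation (X j))\<bar>}"
    by (simp add: mean)
  also have "prob \<dots> \<le> 2 * exp (- 2 * (real n * \<tau>)\<^sup>2 / (\<Sum>j = 1..n. (B - (- B))\<^sup>2))"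
    using assms by (intro Hoeffding_ineq_abs_ge) auto
  also have "- 2 * (real n * \<tau>)\<^sup>2 / (\<Sum>j = 1..n. (B - (- B))\<^sup>2) = - (\<tau>\<^sup>2 / (2 * B\<^sup>2)) * real n"
    using \<open>1 \<le> n\<close> \<open>0 < B\<close> by (simp add: field_simps power2_eq_square)
  finally show ?thesis .
qed

lemma indep_vars_measurable:
  "indep_vars N X I \<Longrightarrow> i \<in> I \<Longrightarrow> X i \<in> measurable M (N i)"
  by (simp add: indep_vars_def)

text \<open>The inner averages are independent for distinct \<open>j\<close>, because they are functions of disjoint groups of
  the samples; they are bounded by \<open>B\<close> and, by Fubini, have the iterated integral as their common
  expectation.  Terms with the same \<open>j\<close> share the sample \<open>Z j\<close> and are dependent, so only the number
  \<open>n\<close> of outer samples enters the rate.\<close>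
lemma nested_average_concentration:
  fixes Z :: "nat \<Rightarrow> 'a \<Rightarrow> 'b" and V :: "nat \<Rightarrow> nat \<Rightarrow> 'a \<Rightarrow> 'b" and G :: "'b \<times> 'b \<Rightarrow> real"
  assumes indep: "indep_vars (\<lambda>_. N) (case_sum Z (\<lambda>(j, i). V j i)) ({1..} <+> {1..} \<times> {1..})"
    and distr: "\<And>j. 1 \<le> j \<Longrightarrow> distr M N (Z j) = \<mu>"
      "\<And>j i. 1 \<le> j \<Longrightarrow> 1 \<le> i \<Longrightarrow> distr M N (V j i) = \<mu>"
    and G: "G \<in> borel_measurable (N \<Otimes>\<^sub>M N)" "\<And>p. \<bar>G p\<bar> \<le> B"
    and "1 \<le> n" "1 \<le> m" "0 < B" "0 < \<tau>"
  shows "prob {\<omega> \<in> space M. \<tau> \<le> \<bar>(\<Sum>j = 1..n. (\<Sum>i = 1..m. G (Z j \<omega>, V j i \<omega>)) / real m) / real n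
      - (\<integral>z. \<integral>v. G (z, v) \<partial>\<mu> \<partial>\<mu>)\<bar>} \<le> 2 * exp (- (\<tau>\<^sup>2 / (2 * B\<^sup>2)) * real n)"
proof -
  let ?X = "case_sum Z (\<lambda>(j, i). V j i)"
  \<comment> \<open>\<open>?K j\<close> collects the indices of the samples that the \<open>j\<close>-th inner average uses.\<close>
  let ?K = "\<lambda>j. insert (Inl j) ((\<lambda>i. Inr (j, i)) ` {1..}) :: (nat + nat \<times> nat) set"
  note G(1)[measurable]
  have rv: "Z j \<in> measurable M N" "1 \<le> i \<Longrightarrow> V j i \<in> measurable M N" if "1 \<le> j" for i j
    using indep_vars_measurable[OF indep, of "Inl j"] indep_vars_measurable[OF indep, of "Inr (j, i)"] that by auto
  let ?A = "\<lambda>j \<omega>. (\<Sum>i = 1..m. G (Z j \<omega>, V j i \<omega>)) / real m"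
  have indep_A: "indep_vars (\<lambda>_. borel) (\<lambda>j \<omega>. (\<Sum>i = 1..m. G (Z j \<omega>, V j i \<omega>)) / real m) {1..n}"
  proof -
    have "indep_vars (\<lambda>j. PiM (?K j) (\<lambda>_. N)) (\<lambda>j \<omega>. restrict (\<lambda>k. ?X k \<omega>) (?K j)) {1..n}"
      by (rule indep_vars_restrict[OF indep]) (auto simp: disjoint_family_on_def)
    then have "indep_vars (\<lambda>_. borel) (\<lambda>j \<omega>. (\<Sum>i = 1..m. G (restrict (\<lambda>k. ?X k \<omega>) (?K j) (Inl j),
        restrict (\<lambda>k. ?X k \<omega>) (?K j) (Inr (j, i)))) / real m) {1..n}"
    proof (rule indep_vars_compose2)
      fix j
      have [measurable]: "(\<lambda>x. x (Inl j)) \<in> PiM (?K j) (\<lambda>_. N) \<rightarrow>\<^sub>M N"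
        by (rule measurable_component_singleton) auto
      have [measurable]: "(\<lambda>x. x (Inr (j, i))) \<in> PiM (?K j) (\<lambda>_. N) \<rightarrow>\<^sub>M N" if "i \<in> {1..m}" for i
        by (rule measurable_component_singleton) (use that in auto)
      show "(\<lambda>x. (\<Sum>i = 1..m. G (x (Inl j), x (Inr (j, i)))) / real m)
          \<in> borel_measurable (PiM (?K j) (\<lambda>_. N))"
        by measurable
    qed
    moreover have "(\<Sum>i = 1..m. G (restrict (\<lambda>k. ?X k \<omega>) (?K j) (Inl j),
        restrict (\<lambda>k. ?X k \<omega>) (?K j) (Inr (j, i)))) = (\<Sum>i = 1..m. G (Z j \<omega>, V j i \<omega>))" for j \<omega>
      by (rule sum.cong) auto
    ultimately show ?thesis by simp
  qed
  have bound_A: "\<bar>(\<Sum>i = 1..m. G (Z j \<omega>, V j i \<omega>)) / real m\<bar> \<le> B" for j \<omega>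
  proof -
    have "\<bar>\<Sum>i = 1..m. G (Z j \<omega>, V j i \<omega>)\<bar> \<le> real (card {1..m}) * B"
      by (rule order_trans[OF sum_abs sum_bounded_above]) (rule G(2))
    then show ?thesis using \<open>1 \<le> m\<close> by (simp add: abs_div_pos[symmetric] field_simps)
  qed
  have mean_A: "integral\<^sup>L M (\<lambda>\<omega>. (\<Sum>i = 1..m. G (Z j \<omega>, V j i \<omega>)) / real m)
      = (\<integral>z. \<integral>v. G (z, v) \<partial>\<mu> \<partial>\<mu>)" if "j \<in> {1..n}" for j
  proof -
    have j: "1 \<le> j" using that by simp
    note [measurable] = rv(1)[OF j]
    have sets_\<mu>: "sets \<mu> = sets N" using distr(1)[OF j] by auto
    note [measurable_cong] = sets_\<mu>
    interpret \<mu>: prob_space \<mu>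
      unfolding distr(1)[OF j, symmetric] by (rule prob_space_distr) simp
    interpret \<mu>\<mu>: pair_prob_space \<mu> \<mu> ..
    have G_\<mu>: "integrable (\<mu> \<Otimes>\<^sub>M \<mu>) G"
      by (rule \<mu>\<mu>.P.integrable_const_bound[where B = B]) (use G(2) in auto)
    have EG: "integrable M (\<lambda>\<omega>. G (Z j \<omega>, V j i \<omega>))"
      "integral\<^sup>L M (\<lambda>\<omega>. G (Z j \<omega>, V j i \<omega>)) = (\<integral>z. \<integral>v. G (z, v) \<partial>\<mu> \<partial>\<mu>)" if i: "1 \<le> i" for i
    proof -
      note [measurable] = rv(2)[OF j i]
      show "integrable M (\<lambda>\<omega>. G (Z j \<omega>, V j i \<omega>))"
        by (rule integrable_const_bound[where B = B]) (use G(2) in auto)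
      have "indep_var (PiM {Inl j} (\<lambda>_. N)) (\<lambda>\<omega>. restrict (\<lambda>k. ?X k \<omega>) {Inl j})
          (PiM {Inr (j, i)} (\<lambda>_. N)) (\<lambda>\<omega>. restrict (\<lambda>k. ?X k \<omega>) {Inr (j, i)})"
        by (rule indep_var_restrict[OF indep]) (use i j in auto)
      then have "indep_var N ((\<lambda>x. x (Inl j)) \<circ> (\<lambda>\<omega>. restrict (\<lambda>k. ?X k \<omega>) {Inl j}))
          N ((\<lambda>x. x (Inr (j, i))) \<circ> (\<lambda>\<omega>. restrict (\<lambda>k. ?X k \<omega>) {Inr (j, i)}))"
        by (rule indep_var_compose) (auto intro!: measurable_component_singleton)
      then have "indep_var N (Z j) N (V j i)" by (simp add: comp_def)
      then have "\<mu> \<Otimes>\<^sub>M \<mu> = distr M (N \<Otimes>\<^sub>M N) (\<lambda>\<omega>. (Z j \<omega>, V j i \<omega>))"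
        unfolding indep_var_distribution_eq by (simp only: distr(1)[OF j] distr(2)[OF j i])
      then have "(\<integral>p. G p \<partial>(\<mu> \<Otimes>\<^sub>M \<mu>)) = integral\<^sup>L M (\<lambda>\<omega>. G (Z j \<omega>, V j i \<omega>))"
        by (simp add: integral_distr)
      then show "integral\<^sup>L M (\<lambda>\<omega>. G (Z j \<omega>, V j i \<omega>)) = (\<integral>z. \<integral>v. G (z, v) \<partial>\<mu> \<partial>\<mu>)"
        using \<mu>\<mu>.integral_fst'[OF G_\<mu>] by simp
    qed
    have "integral\<^sup>L M (\<lambda>\<omega>. \<Sum>i = 1..m. G (Z j \<omega>, V j i \<omega>))
        = real m * (\<integral>z. \<integral>v. G (z, v) \<partial>\<mu> \<partial>\<mu>)"
      by (subst Bochner_Integration.integral_sum) (auto simp: EG)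
    then show ?thesis using \<open>1 \<le> m\<close> by simp
  qed
  show ?thesis
    by (rule bounded_mean_concentration[of ?A, OF indep_A bound_A mean_A \<open>1 \<le> n\<close> \<open>0 < B\<close> \<open>0 < \<tau>\<close>])
qed

end

lemma matrix_component_bounded_linear: "bounded_linear (\<lambda>A :: real^'n^'m. A $ a $ b)"
  by (rule bounded_linear_compose[OF bounded_linear_vec_nth bounded_linear_vec_nth])

lemma quadratic_form_bounded_linear: "bounded_linear (\<lambda>A :: real^'n^'n. x \<bullet> (A *v x))"
  by (simp add: linear_conv_bounded_linear[symmetric] linear_iff matrix_vector_mult_add_rdistrib
      inner_add_right scaleR_matrix_vector_assoc[symmetric])

lemma spec_norm_diff_le:
  fixes A B :: "real^'n^'m"
  shows "spec_norm A \<le> spec_norm B + spec_norm (A - B)"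
proof -
  have "spec_norm A = onorm (\<lambda>x. B *v x + (A - B) *v x)"
    by (simp add: matrix_vector_mult_diff_rdistrib)
  also have "\<dots> \<le> spec_norm B + spec_norm (A - B)"
    by (rule onorm_triangle) auto
  finally show ?thesis .
qed

lemma spec_norm_le_norm:
  fixes A :: "real^'n^'m"
  shows "spec_norm A \<le> real CARD('m) * real CARD('n) * norm A"
proof (rule onorm_le_matrix_component)
  fix i j
  have "\<bar>A $ i $ j\<bar> \<le> norm (A $ i)" by (rule component_le_norm_cart)
  also have "\<dots> \<le> norm A" by (rule Finite_Cartesian_Product.norm_nth_le)
  finally show "\<bar>A $ i $ j\<bar> \<le> norm A" .
qed

lemma spec_norm_measurable [measurable]:
  "(spec_norm :: real^'n^'m \<Rightarrow> real) \<in> borel_measurable borel"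
proof (rule borel_measurable_continuous_onI, rule lipschitz_on_continuous_on, rule lipschitz_onI)
  fix A B :: "real^'n^'m"
  let ?K = "real CARD('m) * real CARD('n)"
  have "spec_norm A - spec_norm B \<le> ?K * norm (A - B)" "spec_norm B - spec_norm A \<le> ?K * norm (A - B)"
    using spec_norm_diff_le[of A B] spec_norm_le_norm[of "A - B"]
      spec_norm_diff_le[of B A] spec_norm_le_norm[of "B - A"]
    by (auto simp: norm_minus_commute)
  then show "dist (spec_norm A) (spec_norm B) \<le> ?K * dist A B"
    by (auto simp: dist_norm abs_le_iff)
qed simp

context prob_space begin

text \<open>Since the spectral norm is at most \<open>d\<^sup>2\<close> times the largest entry, it suffices that each of the
  \<open>d\<^sup>2\<close> entries deviates by less than \<open>\<tau> / d\<^sup>2\<close>; the union bound over the entries costs another factor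
  \<open>d\<^sup>2\<close>.\<close>
lemma nested_matrix_average_concentration:
  fixes Z :: "nat \<Rightarrow> 'a \<Rightarrow> 'b" and V :: "nat \<Rightarrow> nat \<Rightarrow> 'a \<Rightarrow> 'b" and H :: "'b \<times> 'b \<Rightarrow> real^'n^'n"
  assumes indep: "indep_vars (\<lambda>_. N) (case_sum Z (\<lambda>(j, i). V j i)) ({1..} <+> {1..} \<times> {1..})"
    and distr: "\<And>j. 1 \<le> j \<Longrightarrow> distr M N (Z j) = \<mu>"
      "\<And>j i. 1 \<le> j \<Longrightarrow> 1 \<le> i \<Longrightarrow> distr M N (V j i) = \<mu>"
    and H: "H \<in> borel_measurable (N \<Otimes>\<^sub>M N)" "\<And>p a b. \<bar>H p $ a $ b\<bar> \<le> B"
    and C: "\<And>a b. C $ a $ b = (\<integral>z. \<integral>v. H (z, v) $ a $ b \<partial>\<mu> \<partial>\<mu>)"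
    and "1 \<le> n" "1 \<le> m" "0 < B" "0 < \<tau>"
  shows "1 - 2 * (real CARD('n))\<^sup>2 * exp (- ((\<tau> / (real CARD('n))\<^sup>2)\<^sup>2 / (2 * B\<^sup>2)) * real n)
    \<le> prob {\<omega> \<in> space M. spec_norm ((1 / real n) *\<^sub>R (\<Sum>j = 1..n.
        (1 / real m) *\<^sub>R (\<Sum>i = 1..m. H (Z j \<omega>, V j i \<omega>))) - C) \<le> \<tau>}"
proof -
  let ?d = "(real CARD('n))\<^sup>2"
  let ?p = "2 * exp (- ((\<tau> / ?d)\<^sup>2 / (2 * B\<^sup>2)) * real n)"
  define R where "R \<omega> = (1 / real n) *\<^sub>R (\<Sum>j = 1..n.
        (1 / real m) *\<^sub>R (\<Sum>i = 1..m. H (Z j \<omega>, V j i \<omega>))) - C" for \<omega>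
  have entry: "R \<omega> $ a $ b = (\<Sum>j = 1..n. (\<Sum>i = 1..m. H (Z j \<omega>, V j i \<omega>) $ a $ b) / real m) / real n
      - (\<integral>z. \<integral>v. H (z, v) $ a $ b \<partial>\<mu> \<partial>\<mu>)" for \<omega> a b
    by (simp add: R_def C)
  note H(1)[measurable]
  have [measurable]: "Z j \<in> measurable M N" if "j \<in> {1..n}" for j
    using indep_vars_measurable[OF indep, of "Inl j"] that by auto
  have [measurable]: "V j i \<in> measurable M N" if "j \<in> {1..n}" "i \<in> {1..m}" for i j
    using indep_vars_measurable[OF indep, of "Inr (j, i)"] that by auto
  have [measurable]: "R \<in> borel_measurable M"
    unfolding R_def by measurable
  have [measurable]: "(\<lambda>A :: real^'n^'n. A $ a $ b) \<in> borel_measurable borel" for a b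
    by (intro borel_measurable_continuous_onI linear_continuous_on matrix_component_bounded_linear)
  define Bad where "Bad p = {\<omega> \<in> space M. \<tau> / ?d \<le> \<bar>R \<omega> $ fst p $ snd p\<bar>}" for p :: "'n \<times> 'n"
  have Bad_sets[measurable]: "Bad p \<in> sets M" for p
    unfolding Bad_def by measurable
  have Bad: "prob (Bad p) \<le> ?p" for p
    unfolding Bad_def entry
    by (rule nested_average_concentration[OF indep distr, of "\<lambda>q. H q $ fst p $ snd p"])
      (use assms in auto)
  have "prob (\<Union>p\<in>UNIV. Bad p) \<le> (\<Sum>p\<in>UNIV. prob (Bad p))"
    by (rule finite_measure_subadditive_finite) auto
  also have "\<dots> \<le> real (card (UNIV :: ('n \<times> 'n) set)) * ?p"
    by (rule sum_bounded_above) (rule Bad)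
  also have "\<dots> = 2 * ?d * exp (- ((\<tau> / ?d)\<^sup>2 / (2 * B\<^sup>2)) * real n)"
    by (simp add: UNIV_Times_UNIV[symmetric] card_cartesian_product power2_eq_square
        del: UNIV_Times_UNIV)
  finally have "1 - 2 * ?d * exp (- ((\<tau> / ?d)\<^sup>2 / (2 * B\<^sup>2)) * real n) \<le> prob (space M - (\<Union>p\<in>UNIV. Bad p))"
    by (subst prob_compl) auto
  also have "\<dots> \<le> prob {\<omega> \<in> space M. spec_norm (R \<omega>) \<le> \<tau>}"
  proof (rule finite_measure_mono)
    show "space M - (\<Union>p\<in>UNIV. Bad p) \<subseteq> {\<omega> \<in> space M. spec_norm (R \<omega>) \<le> \<tau>}"
    proof safe
      fix \<omega> assume \<omega>: "\<omega> \<in> space M" "\<omega> \<notin> (\<Union>p\<in>UNIV. Bad p)"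
      have "\<bar>R \<omega> $ a $ b\<bar> \<le> \<tau> / ?d" for a b
        using \<omega> by (auto simp: Bad_def not_le intro: less_imp_le)
      then have "spec_norm (R \<omega>) \<le> real CARD('n) * real CARD('n) * (\<tau> / ?d)"
        by (rule onorm_le_matrix_component)
      also have "\<dots> = \<tau>" by (simp add: power2_eq_square)
      finally show "spec_norm (R \<omega>) \<le> \<tau>" .
    qed
  qed measurable
  finally show ?thesis unfolding R_def .
qed

end

section \<open>The matrix C and its positive semidefiniteness\<close>

text \<open>The argument is the pair \<open>(z, v)\<close>, so that the inner integral of \<open>full_C\<close> runs over the second
  component.  The cut-off to \<open>\<Omega> \<times> \<Omega>\<close> yields a function that is measurable and bounded everywhere,
  whatever the values of \<open>f\<close> outside \<open>\<Omega>\<close>.\<close>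
definition grad_outer :: "(real^'d) set \<Rightarrow> (real^'d \<Rightarrow> real) \<Rightarrow> (real^'d) \<times> (real^'d) \<Rightarrow> real^'d^'d" where
  "grad_outer \<Omega> f p = indicator (\<Omega> \<times> \<Omega>) p *\<^sub>R outer (Dz f (snd p) (fst p))"

lemma repl_eq: "repl v z i = z + (v $ i - z $ i) *\<^sub>R axis i 1"
  by (simp add: repl_def vec_eq_iff axis_def)

lemma continuous_on_outer: "continuous_on S outer"
  unfolding outer_def by (intro continuous_intros)

text \<open>The function \<open>f\<close> itself may fail to be measurable, but its extension by zero from \<open>\<Omega>\<close> is Borel.  On
  \<open>\<Omega> \<times> \<Omega>\<close> all points at which \<open>Dz f\<close> evaluates \<open>f\<close> lie in \<open>\<Omega>\<close>, so there the extension can replace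
  \<open>f\<close>.\<close>
lemma grad_outer_measurable [measurable]:
  fixes f :: "real^'d \<Rightarrow> real"
  assumes f: "continuous_on \<Omega> f" and \<Omega>[measurable]: "\<Omega> \<in> sets borel"
    and repl: "\<And>v z i. v \<in> \<Omega> \<Longrightarrow> z \<in> \<Omega> \<Longrightarrow> repl v z i \<in> \<Omega>"
  shows "grad_outer \<Omega> f \<in> borel_measurable (borel \<Otimes>\<^sub>M borel)"
proof -
  define h where "h x = indicator \<Omega> x * f x" for x
  have h[measurable]: "h \<in> borel_measurable borel"
    using borel_measurable_continuous_on_indicator[OF \<Omega> f] by (simp add: h_def[abs_def])
  define D where "D p = (\<Sum>i\<in>UNIV. ((h (fst p + (snd p $ i - fst p $ i) *\<^sub>R axis i 1) - h (fst p))
      / (snd p $ i - fst p $ i)) *\<^sub>R axis i (1 :: real))" for p :: "(real^'d) \<times> (real^'d)"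
  have [measurable]: "(\<lambda>x :: real^'d. x $ i) \<in> borel_measurable borel" for i
    by (intro borel_measurable_continuous_onI continuous_intros)
  have [measurable]: "outer \<in> borel_measurable (borel :: (real^'d) measure)"
    by (intro borel_measurable_continuous_onI continuous_on_outer)
  have D[measurable]: "D \<in> borel_measurable (borel \<Otimes>\<^sub>M borel)"
    unfolding D_def by measurable
  have "Dz f (snd p) (fst p) = D p" if "p \<in> \<Omega> \<times> \<Omega>" for p
  proof -
    have "h (repl (snd p) (fst p) i) = f (repl (snd p) (fst p) i)" "h (fst p) = f (fst p)" for i
      using that repl by (auto simp: h_def)
    then show ?thesis
      by (simp add: D_def Dz_def vec_eq_iff repl_eq axis_def if_distrib cong: if_cong)
  qed
  then have "grad_outer \<Omega> f p = indicator (\<Omega> \<times> \<Omega>) p *\<^sub>R outer (D p)" for p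
    by (auto simp: grad_outer_def indicator_def)
  then have "grad_outer \<Omega> f = (\<lambda>p. indicator (\<Omega> \<times> \<Omega>) p *\<^sub>R outer (D p))" by blast
  then show ?thesis by simp
qed

text \<open>The points \<open>repl v z i\<close> and \<open>z\<close> are at distance \<open>\<bar>v\<^sub>i - z\<^sub>i\<bar>\<close>.  The bound also covers the default value
  \<open>0\<close> at \<open>v\<^sub>i = z\<^sub>i\<close>, so it holds at every pair of points and not only almost everywhere.\<close>
lemma Dz_component_bound:
  assumes f: "K-lipschitz_on \<Omega> f" and "v \<in> \<Omega>" "z \<in> \<Omega>" and repl: "repl v z i \<in> \<Omega>"
  shows "\<bar>Dz f v z $ i\<bar> \<le> K"
proof (cases "v $ i = z $ i")
  case True
  then show ?thesis using lipschitz_on_nonneg[OF f] by (simp add: Dz_def)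
next
  case False
  have "\<bar>f (repl v z i) - f z\<bar> \<le> K * dist (repl v z i) z"
    using lipschitz_onD[OF f repl \<open>z \<in> \<Omega>\<close>] by (simp add: dist_real_def)
  also have "dist (repl v z i) z = \<bar>v $ i - z $ i\<bar>"
    by (simp add: repl_eq dist_norm norm_axis_1)
  finally show ?thesis using False by (simp add: Dz_def pos_divide_le_eq)
qed

lemma grad_outer_entry_bound:
  assumes f: "K-lipschitz_on \<Omega> f" and repl: "\<And>v z i. v \<in> \<Omega> \<Longrightarrow> z \<in> \<Omega> \<Longrightarrow> repl v z i \<in> \<Omega>"
  shows "\<bar>grad_outer \<Omega> f p $ a $ b\<bar> \<le> K\<^sup>2"
proof (cases "p \<in> \<Omega> \<times> \<Omega>")
  case True
  have "\<bar>Dz f (snd p) (fst p) $ a\<bar> * \<bar>Dz f (snd p) (fst p) $ b\<bar> \<le> K * K"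
    using True lipschitz_on_nonneg[OF f]
    by (intro mult_mono Dz_component_bound[OF f] repl) auto
  then show ?thesis using True by (simp add: grad_outer_def outer_def abs_mult power2_eq_square)
qed (simp add: grad_outer_def)

lemma norm_le_entries:
  fixes A :: "real^'n^'m"
  assumes "\<And>a b. \<bar>A $ a $ b\<bar> \<le> B"
  shows "norm A \<le> real CARD('m) * (real CARD('n) * B)"
proof -
  have "norm A \<le> (\<Sum>a\<in>UNIV. norm (A $ a))"
    by (simp add: norm_vec_def L2_set_le_sum)
  also have "\<dots> \<le> real CARD('m) * (real CARD('n) * B)"
  proof (rule sum_bounded_above)
    fix a
    have "norm (A $ a) \<le> (\<Sum>b\<in>UNIV. \<bar>A $ a $ b\<bar>)" by (rule norm_le_l1_cart)
    also have "\<dots> \<le> real CARD('n) * B" by (rule sum_bounded_above) (rule assms)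
    finally show "norm (A $ a) \<le> real CARD('n) * B" .
  qed
  finally show ?thesis .
qed

locale difference_gradient = prob_space \<mu> for \<mu> :: "(real^'d) measure" +
  fixes \<Omega> :: "(real^'d) set" and f :: "real^'d \<Rightarrow> real" and K :: real
  assumes sets_\<mu> [measurable_cong]: "sets \<mu> = sets borel"
    and \<Omega> [measurable]: "\<Omega> \<in> sets borel"
    and repl_in: "\<And>v z i. v \<in> \<Omega> \<Longrightarrow> z \<in> \<Omega> \<Longrightarrow> repl v z i \<in> \<Omega>"
    and lipschitz: "K-lipschitz_on \<Omega> f"
begin

lemma measurable_grad_outer [measurable]: "grad_outer \<Omega> f \<in> borel_measurable (borel \<Otimes>\<^sub>M borel)"
  by (rule grad_outer_measurable[OF lipschitz_on_continuous_on[OF lipschitz] \<Omega> repl_in])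

lemma norm_grad_outer_le: "norm (grad_outer \<Omega> f p) \<le> real CARD('d) * (real CARD('d) * K\<^sup>2)"
  by (rule norm_le_entries) (rule grad_outer_entry_bound[OF lipschitz repl_in])

lemma integrable_grad_outer: "integrable \<mu> (\<lambda>v. grad_outer \<Omega> f (z, v))"
  by (rule integrable_const_bound[where B = "real CARD('d) * (real CARD('d) * K\<^sup>2)"])
    (auto simp: norm_grad_outer_le)

lemma cond_C_eq: "z \<in> \<Omega> \<Longrightarrow> cond_C \<mu> \<Omega> f z = (\<integral>v. grad_outer \<Omega> f (z, v) \<partial>\<mu>)"
  unfolding cond_C_def set_lebesgue_integral_def grad_outer_def
  by (rule Bochner_Integration.integral_cong) (auto simp: indicator_def)

lemma full_C_eq: "full_C \<mu> \<Omega> f = (\<integral>z. \<integral>v. grad_outer \<Omega> f (z, v) \<partial>\<mu> \<partial>\<mu>)"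
  unfolding full_C_def set_lebesgue_integral_def
proof (rule Bochner_Integration.integral_cong)
  fix z
  show "indicator \<Omega> z *\<^sub>R cond_C \<mu> \<Omega> f z = (\<integral>v. grad_outer \<Omega> f (z, v) \<partial>\<mu>)"
    by (cases "z \<in> \<Omega>") (simp_all add: cond_C_eq, simp add: grad_outer_def)
qed simp

lemma measurable_cond_mean [measurable]:
  "(\<lambda>z. \<integral>v. grad_outer \<Omega> f (z, v) \<partial>\<mu>) \<in> borel_measurable borel"
proof -
  have "(\<lambda>(z, v). grad_outer \<Omega> f (z, v)) \<in> borel_measurable (borel \<Otimes>\<^sub>M \<mu>)"
    by simp
  then show ?thesis by (rule borel_measurable_lebesgue_integral)
qed

lemma integrable_cond_mean: "integrable \<mu> (\<lambda>z. \<integral>v. grad_outer \<Omega> f (z, v) \<partial>\<mu>)"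
proof (rule integrable_const_bound[where B = "real CARD('d) * (real CARD('d) * K\<^sup>2)"])
  have "norm (\<integral>v. grad_outer \<Omega> f (z, v) \<partial>\<mu>) \<le> real CARD('d) * (real CARD('d) * K\<^sup>2)" for z
  proof -
    have "norm (\<integral>v. grad_outer \<Omega> f (z, v) \<partial>\<mu>) \<le> (\<integral>v. norm (grad_outer \<Omega> f (z, v)) \<partial>\<mu>)"
      by (rule integral_norm_bound)
    also have "\<dots> \<le> real CARD('d) * (real CARD('d) * K\<^sup>2)"
      by (rule integral_le_const) (auto simp: norm_grad_outer_le integrable_grad_outer)
    finally show ?thesis .
  qed
  then show "AE z in \<mu>. norm (\<integral>v. grad_outer \<Omega> f (z, v) \<partial>\<mu>) \<le> real CARD('d) * (real CARD('d) * K\<^sup>2)"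
    by simp
qed measurable

text \<open>The main uses of \<open>T\<close> are the entries, whose means Hoeffding's inequality refers to, and the
  quadratic forms, which decide positive semidefiniteness.\<close>
lemma bounded_linear_full_C:
  fixes T :: "real^'d^'d \<Rightarrow> real"
  assumes "bounded_linear T"
  shows "T (full_C \<mu> \<Omega> f) = (\<integral>z. \<integral>v. T (grad_outer \<Omega> f (z, v)) \<partial>\<mu> \<partial>\<mu>)"
  unfolding full_C_eq
  by (simp add: integral_bounded_linear[OF assms integrable_cond_mean, symmetric]
      integral_bounded_linear[OF assms integrable_grad_outer, symmetric])

text \<open>The quadratic form of \<open>C\<close> at \<open>x\<close> is the mean of \<open>(Dz f \<bullet> x)\<^sup>2\<close>.\<close>
lemma full_C_nonneg: "0 \<le> x \<bullet> (full_C \<mu> \<Omega> f *v x)"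
proof -
  have "x \<bullet> (outer y *v x) = (y \<bullet> x)\<^sup>2" for y :: "real^'d"
  proof -
    have "outer y *v x = (y \<bullet> x) *\<^sub>R y"
      by (simp add: outer_def vec_eq_iff matrix_vector_mult_def inner_vec_def sum_distrib_left
          sum_distrib_right mult_ac)
    then show ?thesis by (simp add: power2_eq_square inner_commute)
  qed
  then have "0 \<le> x \<bullet> (grad_outer \<Omega> f p *v x)" for p
    by (simp add: grad_outer_def scaleR_matrix_vector_assoc[symmetric] indicator_def)
  then show ?thesis
    unfolding bounded_linear_full_C[OF quadratic_form_bounded_linear]
    by (intro Bochner_Integration.integral_nonneg) auto
qed

end

section \<open>Concentration of the Monte Carlo estimate\<close>

locale sampled_difference_gradient = difference_gradient \<mu> \<Omega> f K + M: prob_space M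
  for \<mu> :: "(real^'d) measure" and \<Omega> f K and M :: "'w measure" +
  fixes Z :: "nat \<Rightarrow> 'w \<Rightarrow> real^'d" and V :: "nat \<Rightarrow> nat \<Rightarrow> 'w \<Rightarrow> real^'d"
  assumes indep: "M.indep_vars (\<lambda>_. borel) (case_sum Z (\<lambda>(j, i). V j i)) ({1..} <+> {1..} \<times> {1..})"
    and distr_Z: "\<And>j. 1 \<le> j \<Longrightarrow> distr M borel (Z j) = \<mu>"
    and distr_V: "\<And>j i. 1 \<le> j \<Longrightarrow> 1 \<le> i \<Longrightarrow> distr M borel (V j i) = \<mu>"
    and Z_in: "\<And>j \<omega>. 1 \<le> j \<Longrightarrow> \<omega> \<in> space M \<Longrightarrow> Z j \<omega> \<in> \<Omega>"
    and V_in: "\<And>j i \<omega>. 1 \<le> j \<Longrightarrow> 1 \<le> i \<Longrightarrow> \<omega> \<in> space M \<Longrightarrow> V j i \<omega> \<in> \<Omega>"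
begin

lemma Z_measurable: "1 \<le> j \<Longrightarrow> Z j \<in> borel_measurable M"
  using M.indep_vars_measurable[OF indep, of "Inl j"] by auto

lemma V_measurable: "1 \<le> j \<Longrightarrow> 1 \<le> i \<Longrightarrow> V j i \<in> borel_measurable M"
  using M.indep_vars_measurable[OF indep, of "Inr (j, i)"] by auto

lemma hat_C_eq:
  assumes "\<omega> \<in> space M"
  shows "hat_C f n m (\<lambda>j. Z j \<omega>) (\<lambda>j i. V j i \<omega>) =
    (1 / real n) *\<^sub>R (\<Sum>j = 1..n. (1 / real m) *\<^sub>R (\<Sum>i = 1..m. grad_outer \<Omega> f (Z j \<omega>, V j i \<omega>)))"
proof -
  have "grad_outer \<Omega> f (Z j \<omega>, V j i \<omega>) = outer (Dz f (V j i \<omega>) (Z j \<omega>))" if "1 \<le> j" "1 \<le> i" for i j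
    using Z_in[of j \<omega>] V_in[of j i \<omega>] that assms by (simp add: grad_outer_def)
  then show ?thesis by (simp add: hat_C_def tilde_Cj_def)
qed

lemma hat_C_measurable: "(\<lambda>\<omega>. hat_C f n m (\<lambda>j. Z j \<omega>) (\<lambda>j i. V j i \<omega>)) \<in> borel_measurable M"
proof -
  have [measurable]: "Z j \<in> borel_measurable M" if "j \<in> {1..n}" for j
    using that by (intro Z_measurable) auto
  have [measurable]: "V j i \<in> borel_measurable M" if "j \<in> {1..n}" "i \<in> {1..m}" for i j
    using that by (intro V_measurable) auto
  have "(\<lambda>\<omega>. (1 / real n) *\<^sub>R (\<Sum>j = 1..n. (1 / real m) *\<^sub>R
      (\<Sum>i = 1..m. grad_outer \<Omega> f (Z j \<omega>, V j i \<omega>)))) \<in> borel_measurable M"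
    by measurable
  then show ?thesis
    by (rule measurable_cong[THEN iffD1, rotated]) (simp add: hat_C_eq)
qed

lemma avg_norm_C_measurable: "(\<lambda>\<omega>. avg_norm_C \<mu> \<Omega> f n (\<lambda>j. Z j \<omega>)) \<in> borel_measurable M"
proof -
  have [measurable]: "Z j \<in> borel_measurable M" if "j \<in> {1..n}" for j
    using that by (intro Z_measurable) auto
  have "(\<lambda>\<omega>. (1 / real n) * (\<Sum>j = 1..n. spec_norm (\<integral>v. grad_outer \<Omega> f (Z j \<omega>, v) \<partial>\<mu>)))
      \<in> borel_measurable M"
  proof -
    have "(\<lambda>\<omega>. spec_norm (\<integral>v. grad_outer \<Omega> f (Z j \<omega>, v) \<partial>\<mu>)) \<in> borel_measurable M" if "j \<in> {1..n}" for j
      using measurable_compose[OF Z_measurable measurable_compose[OF measurable_cond_mean spec_norm_measurable], of j]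
        that by simp
    then show ?thesis by measurable
  qed
  then show ?thesis
    by (rule measurable_cong[THEN iffD1, rotated]) (simp add: avg_norm_C_def cond_C_eq Z_in)
qed

text \<open>The threshold \<open>N\<close> is chosen before \<open>m\<close>, since the exponential rate depends on \<open>n\<close> only.  The bound
  \<open>K\<^sup>2\<close> on the entries is enlarged to \<open>K\<^sup>2 + 1\<close> because Hoeffding's inequality asks for a positive bound and
  \<open>K\<close> may be \<open>0\<close>.\<close>
lemma hat_C_concentration:
  assumes "0 < \<tau>" "0 < \<delta>"
  shows "\<exists>N. \<forall>n\<ge>N. \<forall>m\<ge>1. 1 - \<delta> \<le> measure M {\<omega> \<in> space M.
    spec_norm (hat_C f n m (\<lambda>j. Z j \<omega>) (\<lambda>j i. V j i \<omega>) - full_C \<mu> \<Omega> f) \<le> \<tau>}"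
proof -
  let ?d = "(real CARD('d))\<^sup>2" and ?B = "K\<^sup>2 + 1"
  define k where "k = (\<tau> / ?d)\<^sup>2 / (2 * ?B\<^sup>2)"
  have B: "0 < ?B" by (simp add: add_nonneg_pos)
  then have "0 < k" using \<open>0 < \<tau>\<close> by (simp add: k_def)
  then have "(\<lambda>n. 2 * ?d * exp (- k) ^ n) \<longlonglongrightarrow> 0"
    by (intro tendsto_mult_right_zero LIMSEQ_realpow_zero) auto
  then have "(\<lambda>n. 2 * ?d * exp (- k * real n)) \<longlonglongrightarrow> 0"
    by (simp add: exp_of_nat_mult[symmetric] mult.commute)
  then have "\<forall>\<^sub>F n in sequentially. 2 * ?d * exp (- k * real n) < \<delta>"
    using \<open>0 < \<delta>\<close> by (rule order_tendstoD)
  then obtain N where N: "\<And>n. N \<le> n \<Longrightarrow> 2 * ?d * exp (- k * real n) < \<delta>"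
    by (auto simp: eventually_sequentially)
  have "1 - \<delta> \<le> measure M {\<omega> \<in> space M.
      spec_norm (hat_C f n m (\<lambda>j. Z j \<omega>) (\<lambda>j i. V j i \<omega>) - full_C \<mu> \<Omega> f) \<le> \<tau>}"
    if "max 1 N \<le> n" "1 \<le> m" for n m
  proof -
    have entry: "\<bar>grad_outer \<Omega> f p $ a $ b\<bar> \<le> ?B" for p a b
      using grad_outer_entry_bound[OF lipschitz repl_in, of p a b] by simp
    have n: "1 \<le> n" "N \<le> n" using that by auto
    have "1 - 2 * ?d * exp (- k * real n) \<le> measure M {\<omega> \<in> space M. spec_norm ((1 / real n) *\<^sub>R (\<Sum>j = 1..n.
        (1 / real m) *\<^sub>R (\<Sum>i = 1..m. grad_outer \<Omega> f (Z j \<omega>, V j i \<omega>))) - full_C \<mu> \<Omega> f) \<le> \<tau>}"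
      unfolding k_def
      by (rule M.nested_matrix_average_concentration[OF indep distr_Z distr_V measurable_grad_outer entry
            bounded_linear_full_C[OF matrix_component_bounded_linear] n(1) \<open>1 \<le> m\<close> B \<open>0 < \<tau>\<close>])
    also have "{\<omega> \<in> space M. spec_norm ((1 / real n) *\<^sub>R (\<Sum>j = 1..n.
        (1 / real m) *\<^sub>R (\<Sum>i = 1..m. grad_outer \<Omega> f (Z j \<omega>, V j i \<omega>))) - full_C \<mu> \<Omega> f) \<le> \<tau>}
      = {\<omega> \<in> space M. spec_norm (hat_C f n m (\<lambda>j. Z j \<omega>) (\<lambda>j i. V j i \<omega>) - full_C \<mu> \<Omega> f) \<le> \<tau>}"
      by (simp add: hat_C_eq cong: conj_cong)
    finally show ?thesis using N[OF n(2)] by linarith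
  qed
  then show ?thesis by blast
qed

end

section \<open>The error of the estimated eigenspaces\<close>

lemma avg_norm_C_nonneg: "0 \<le> avg_norm_C \<mu> \<Omega> f n zs"
  unfolding avg_norm_C_def by (intro mult_nonneg_nonneg sum_nonneg onorm_pos_le) auto

theorem theorem4p4:
  fixes F :: "'d::{finite,linorder} \<Rightarrow> real \<Rightarrow> real"
    and \<mu> :: "(real^('d::{finite,linorder})) measure"
    and \<Omega> :: "(real^('d::{finite,linorder})) set"
    and f :: "real^('d::{finite,linorder}) \<Rightarrow> real"
    and L \<epsilon>' \<epsilon>'' :: real
    and M :: "'w measure"
    and Z :: "nat \<Rightarrow> 'w \<Rightarrow> real^('d::{finite,linorder})"
    and V :: "nat \<Rightarrow> nat \<Rightarrow> 'w \<Rightarrow> real^('d::{finite,linorder})"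
    and U :: "real^('d::{finite,linorder})^('d::{finite,linorder})"
    and lam :: "nat \<Rightarrow> real"
    and d1 :: nat
  assumes F_cdf: "\<And>i. mono (F i)" "\<And>i. continuous_on UNIV (F i)"
      "\<And>i. (F i \<longlongrightarrow> 0) at_bot" "\<And>i. (F i \<longlongrightarrow> 1) at_top"
    and \<mu>: "prob_space \<mu>" "sets \<mu> = sets borel"
      "\<And>z. measure \<mu> {x. \<forall>i. x $ i \<le> z $ i} = (\<Prod>i\<in>UNIV. F i (z $ i))"
    and \<Omega>: "\<Omega> \<in> sets borel" "measure \<mu> \<Omega> = 1"
      "\<And>v z i. v \<in> \<Omega> \<Longrightarrow> z \<in> \<Omega> \<Longrightarrow> repl v z i \<in> \<Omega>"
    and f_lipschitz: "\<exists>K. K-lipschitz_on \<Omega> f"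
    and f_bound: "\<And>v z. v \<in> \<Omega> \<Longrightarrow> z \<in> \<Omega> \<Longrightarrow> (\<forall>i. v $ i \<noteq> z $ i) \<Longrightarrow> norm (Dz f v z) \<le> L"
    and M: "prob_space M"
    and samples_indep: "prob_space.indep_vars M (\<lambda>_. borel)
          (case_sum Z (\<lambda>(j, i). V j i)) ({1..} <+> {1..} \<times> {1..})"
    and samples_distr: "\<And>j. 1 \<le> j \<Longrightarrow> distr M borel (Z j) = \<mu>"
      "\<And>j i. 1 \<le> j \<Longrightarrow> 1 \<le> i \<Longrightarrow> distr M borel (V j i) = \<mu>"
    and samples_in: "\<And>j \<omega>. 1 \<le> j \<Longrightarrow> \<omega> \<in> space M \<Longrightarrow> Z j \<omega> \<in> \<Omega>"
      "\<And>j i \<omega>. 1 \<le> j \<Longrightarrow> 1 \<le> i \<Longrightarrow> \<omega> \<in> space M \<Longrightarrow> V j i \<omega> \<in> \<Omega>"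
    and eig: "eig_decomp (full_C \<mu> \<Omega> f) U lam"
    and d1: "1 \<le> d1" "d1 < CARD('d::{finite,linorder})" "lam (d1 + 1) < lam d1"
      "CARD('p::{finite,linorder}) = d1" "CARD('q::{finite,linorder}) = CARD('d::{finite,linorder}) - d1"
    and eps: "0 < \<epsilon>'" "0 < \<epsilon>''"
  shows "\<forall>\<delta>>0. \<exists>N1 N2. \<forall>M1\<ge>N1. \<forall>M2\<ge>N2.
      cond_indep_events M (sigma_Z M Z M1)
        (\<lambda>j. if j = 0
          then {\<omega> \<in> space M. spec_norm (tilde_C \<mu> \<Omega> f M1 (\<lambda>j. Z j \<omega>) - full_C \<mu> \<Omega> f)
                               \<le> \<epsilon>' * spec_norm (full_C \<mu> \<Omega> f)}
          else {\<omega> \<in> space M. spec_norm (tilde_Cj f M2 (\<lambda>j. Z j \<omega>) (\<lambda>j i. V j i \<omega>) j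
                                           - cond_C \<mu> \<Omega> f (Z j \<omega>))
                               \<le> \<epsilon>'' * spec_norm (cond_C \<mu> \<Omega> f (Z j \<omega>))})
        {0..M1} \<longrightarrow>
      measure M {\<omega> \<in> space M.
          spec_norm (hat_C f M1 M2 (\<lambda>j. Z j \<omega>) (\<lambda>j i. V j i \<omega>) - full_C \<mu> \<Omega> f)
            \<le> \<epsilon>'' * avg_norm_C \<mu> \<Omega> f M1 (\<lambda>j. Z j \<omega>) + \<epsilon>' * spec_norm (full_C \<mu> \<Omega> f)}
        \<ge> 1 - \<delta> \<and>
      (\<exists>E\<in>sets M. measure M E \<ge> 1 - \<delta> \<and>
        (\<forall>\<omega>\<in>E. \<epsilon>'' * avg_norm_C \<mu> \<Omega> f M1 (\<lambda>j. Z j \<omega>) + \<epsilon>' * lam 1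
                   \<le> (lam d1 - lam (d1 + 1)) / 5 \<longrightarrow>
          (\<forall>Uhat lamhat. eig_decomp (hat_C f M1 M2 (\<lambda>j. Z j \<omega>) (\<lambda>j i. V j i \<omega>)) Uhat lamhat \<longrightarrow>
            spec_norm (transpose (first_cols U :: real^('p::{finite,linorder})^('d::{finite,linorder})) ** (last_cols Uhat :: real^('q::{finite,linorder})^('d::{finite,linorder})))
              \<le> 4 * (\<epsilon>'' * avg_norm_C \<mu> \<Omega> f M1 (\<lambda>j. Z j \<omega>) + \<epsilon>' * lam 1)
                  / (lam d1 - lam (d1 + 1)))))"
proof (intro allI impI, goal_cases)
  case (1 \<delta>)
  obtain K where K: "K-lipschitz_on \<Omega> f" using f_lipschitz by blast
  interpret M: prob_space M by (rule M)
  interpret \<mu>: prob_space \<mu> by (rule \<mu>(1))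
  interpret S: sampled_difference_gradient \<mu> \<Omega> f K M Z V
    using \<mu>(2) \<Omega> K samples_indep samples_distr samples_in by unfold_locales
  let ?C = "full_C \<mu> \<Omega> f"
  let ?hat = "\<lambda>M1 M2 \<omega>. hat_C f M1 M2 (\<lambda>j. Z j \<omega>) (\<lambda>j i. V j i \<omega>)"
  let ?avg = "\<lambda>M1 \<omega>. avg_norm_C \<mu> \<Omega> f M1 (\<lambda>j. Z j \<omega>)"
  let ?gap = "lam d1 - lam (d1 + 1)"
  let ?Good = "\<lambda>M1 M2. {\<omega> \<in> space M. spec_norm (?hat M1 M2 \<omega> - ?C) \<le> \<epsilon>' * lam 1}"
  \<comment> \<open>The gap lies between eigenvalues of a positive semidefinite matrix, so \<open>\<lambda>\<^sub>1\<close> is positive.\<close>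
  have "0 \<le> lam CARD('d)"
    using S.full_C_nonneg[of "column (inv pos CARD('d)) U"]
    by (simp add: eig_decomp_column[OF eig] pos_inv dot_square_norm eig_decomp_norm_column[OF eig])
  then have lam_1: "0 < lam 1"
    using eig_decomp_mono[OF eig, of "d1 + 1" "CARD('d)"] eig_decomp_mono[OF eig, of 1 d1] d1 by auto
  have "spec_norm ?C \<ge> lam 1"
    using onorm[OF matrix_vector_mul_bounded_linear, of ?C "column (inv pos 1) U"] lam_1
    by (simp add: eig_decomp_column[OF eig] pos_inv eig_decomp_norm_column[OF eig])
  then have lam_1_le: "\<epsilon>' * lam 1 \<le> \<epsilon>' * spec_norm ?C"
    using eps by simp
  note [measurable] = S.hat_C_measurable S.avg_norm_C_measurable
  obtain N where N: "\<And>M1 M2. N \<le> M1 \<Longrightarrow> 1 \<le> M2 \<Longrightarrow> 1 - \<delta> \<le> measure M (?Good M1 M2)"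
    using S.hat_C_concentration[of "\<epsilon>' * lam 1" \<delta>] eps lam_1 1 by auto
  show ?case
  proof (rule exI[of _ N], rule exI[of _ 1], intro allI impI conjI, goal_cases)
    case (1 M1 M2)
    then have "1 - \<delta> \<le> measure M (?Good M1 M2)" by (intro N)
    also have "\<dots> \<le> measure M {\<omega> \<in> space M. spec_norm (?hat M1 M2 \<omega> - ?C)
        \<le> \<epsilon>'' * ?avg M1 \<omega> + \<epsilon>' * spec_norm ?C}"
    proof (rule M.finite_measure_mono)
      have "0 \<le> \<epsilon>'' * ?avg M1 \<omega>" for \<omega>
        using eps avg_norm_C_nonneg by (intro mult_nonneg_nonneg) auto
      then show "?Good M1 M2 \<subseteq> {\<omega> \<in> space M. spec_norm (?hat M1 M2 \<omega> - ?C)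
          \<le> \<epsilon>'' * ?avg M1 \<omega> + \<epsilon>' * spec_norm ?C}"
        using lam_1_le by (auto intro: order_trans add_increasing)
    qed measurable
    finally show ?case .
  next
    case (2 M1 M2)
    show ?case
    proof (intro bexI[of _ "?Good M1 M2"] conjI ballI impI allI)
      show "1 - \<delta> \<le> measure M (?Good M1 M2)" using 2 by (intro N)
      show "?Good M1 M2 \<in> sets M" by measurable
      fix \<omega> Uhat lamhat
      let ?s = "\<epsilon>'' * ?avg M1 \<omega> + \<epsilon>' * lam 1" and ?e = "spec_norm (?hat M1 M2 \<omega> - ?C)"
      let ?W = "transpose (first_cols U :: real^('p::{finite,linorder})^('d::{finite,linorder})) ** (last_cols Uhat :: real^('q::{finite,linorder})^('d::{finite,linorder}))"
      assume \<omega>: "\<omega> \<in> ?Good M1 M2" and small: "?s \<le> ?gap / 5"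
        and hat: "eig_decomp (?hat M1 M2 \<omega>) Uhat lamhat"
      have gap: "0 < ?gap" using d1 by simp
      have "0 \<le> \<epsilon>'' * ?avg M1 \<omega>"
        using eps avg_norm_C_nonneg by (intro mult_nonneg_nonneg) auto
      then have s: "0 \<le> ?s" and e: "?e \<le> ?s" "?e \<le> ?gap / 5"
        using \<omega> small eps lam_1 by auto
      \<comment> \<open>A perturbation of norm at most \<open>gap / 5\<close> leaves at least four fifths of the gap.\<close>
      have "(4 / 5 * ?gap) * spec_norm ?W \<le> (?gap - ?e) * spec_norm ?W"
        using e by (intro mult_right_mono onorm_pos_le) auto
      also have "\<dots> \<le> ?e"
        using e gap d1 by (intro eigenspace_perturbation[OF eig hat]) auto
      also have "\<dots> \<le> ?s" by (rule e)
      finally have "spec_norm ?W * ?gap \<le> 5 / 4 * ?s" by (simp add: algebra_simps)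
      also have "\<dots> \<le> 4 * ?s"
        using s by (intro mult_right_mono) auto
      finally show "spec_norm ?W \<le> 4 * ?s / ?gap"
        using gap by (simp only: pos_le_divide_eq)
    qed
  qed
qed

end
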